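(* Let $n\ge1$, $T\in\mathbb{Z}_2^n$, and $$X=\{(0,0,0),(1,1,1),(2,2,2),(3,3,3),(0,1,2),(1,0,3),(2,3,0),(3,2,1)\}\subset\mathbb{Z}_4^3 .$$ Let $f:(\mathbb{Z}_2^n)^3\to\{0,1\}$ be defined by $f(x,y,z)=1$ if and only if $x+y+z=T$. Then $\alpha_3(f)$ is equal to the largest cardinality of an $X$-free subset of $\mathbb{Z}_4^n$.
   Context: A subset $W\subseteq\mathbb{Z}_4^n$ is $X$-free if for every three distinct members $\mathbf{x},\mathbf{y},\mathbf{z}\in W$ (taken in any order) there is an index $1\le i\le n$ for which $(x_i,y_i,z_i)\notin X$. In a product $X_1\times X_2\times X_3$ (here each factor is $\mathbb{Z}_2^n$), a cylinder in dimension $i$ is a subset closed under arbitrary changes of the $i$-th coordinate, and a cylinder intersection is a set $T_1\cap T_2\cap T_3$ with $T_i$ a cylinder in dimension $i$. $\alpha_3(f)$ is the largest cardinality of a cylinder intersection contained in $f^{-1}(1)$. *)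

theory Defs
  imports "HOL-Analysis.Finite_Cartesian_Product" "HOL-Library.Numeral_Type"
begin

text \<open>
  The integers modulo \<open>2\<close> and modulo \<open>4\<close> are the numeral types \<open>2\<close> and \<open>4\<close>, whose ring
  operations are modular.  Vectors of length \<open>n\<close> are indexed by a finite type \<open>'n\<close> with
  \<open>n = CARD('n)\<close>; since types are nonempty, \<open>n \<ge> 1\<close> holds automatically.
\<close>

definition cylinder1 :: "('a \<times> 'b \<times> 'c) set \<Rightarrow> bool" where
  "cylinder1 C \<longleftrightarrow> (\<forall>x x' y z. (x, y, z) \<in> C \<longrightarrow> (x', y, z) \<in> C)"

definition cylinder2 :: "('a \<times> 'b \<times> 'c) set \<Rightarrow> bool" where
  "cylinder2 C \<longleftrightarrow> (\<forall>x y y' z. (x, y, z) \<in> C \<longrightarrow> (x, y', z) \<in> C)"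

definition cylinder3 :: "('a \<times> 'b \<times> 'c) set \<Rightarrow> bool" where
  "cylinder3 C \<longleftrightarrow> (\<forall>x y z z'. (x, y, z) \<in> C \<longrightarrow> (x, y, z') \<in> C)"

definition cylinder_intersection :: "('a \<times> 'b \<times> 'c) set \<Rightarrow> bool" where
  "cylinder_intersection S \<longleftrightarrow>
     (\<exists>C1 C2 C3. cylinder1 C1 \<and> cylinder2 C2 \<and> cylinder3 C3 \<and> S = C1 \<inter> C2 \<inter> C3)"

text \<open>
  The factors are finite types and the empty set is a cylinder intersection, so \<open>Max\<close> ranges
  over a finite nonempty set.
\<close>

definition alpha3 :: "('a::finite \<times> 'b::finite \<times> 'c::finite \<Rightarrow> nat) \<Rightarrow> nat" where
  "alpha3 f = Max {card S | S. cylinder_intersection S \<and> S \<subseteq> f -` {1}}"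

text \<open>
  The vectors \<open>x\<close>, \<open>y\<close>, \<open>z\<close> range independently over \<open>W\<close>, so every ordering of three distinct
  members is covered.
\<close>

definition X_free :: "('a \<times> 'a \<times> 'a) set \<Rightarrow> ('a ^ 'n) set \<Rightarrow> bool" where
  "X_free X W \<longleftrightarrow>
     (\<forall>x\<in>W. \<forall>y\<in>W. \<forall>z\<in>W. x \<noteq> y \<and> x \<noteq> z \<and> y \<noteq> z \<longrightarrow>
        (\<exists>i. (x $ i, y $ i, z $ i) \<notin> X))"

end

theory Submission
  imports Defs "HOL-Analysis.Cartesian_Space"
begin

text \<open>
  A subset of the plane \<open>x + y + z = T\<close> is a cylinder intersection iff its projection to the
  first two coordinates contains no corner \<open>(a + d, b)\<close>, \<open>(a, b + d)\<close>, \<open>(a, b)\<close> with \<open>d \<noteq> 0\<close>.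
  Over \<open>\<int>\<^sub>2\<close> the pair of coordinates \<open>(a\<^sub>i, b\<^sub>i)\<close> can be encoded by an element of \<open>\<int>\<^sub>4\<close> in such a
  way that \<open>X\<close> becomes exactly the set of one-dimensional corners, degenerate ones (\<open>d = 0\<close>)
  included; hence corner-free sets correspond to \<open>X\<close>-free ones.
\<close>

definition corner_free :: "('a::ab_group_add \<times> 'a) set \<Rightarrow> bool" where
  "corner_free D \<longleftrightarrow>
     (\<forall>a b d. (a + d, b) \<in> D \<and> (a, b + d) \<in> D \<and> (a, b) \<in> D \<longrightarrow> d = 0)"

text \<open>Freeing the i-th coordinate of \<open>S\<close> gives the least cylinder in dimension i
  that contains \<open>S\<close>. So \<open>S\<close> is a cylinder intersection exactly when it
  contains the intersection of these three hulls, and a point of that intersection is the centre of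
  a star with its three tips in \<open>S\<close>.\<close>

lemma cylinder_intersection_iff_star_closed:
  fixes S :: "('a \<times> 'b \<times> 'c) set"
  shows "cylinder_intersection S \<longleftrightarrow>
     (\<forall>x x' y y' z z'. (x', y, z) \<in> S \<and> (x, y', z) \<in> S \<and> (x, y, z') \<in> S \<longrightarrow> (x, y, z) \<in> S)"
  (is "?L \<longleftrightarrow> ?R")
proof
  assume ?L
  then show ?R
    unfolding cylinder_intersection_def cylinder1_def cylinder2_def cylinder3_def by blast
next
  assume R: ?R
  let ?C1 = "{(x, y, z). \<exists>x'. (x', y, z) \<in> S}"
  let ?C2 = "{(x, y, z). \<exists>y'. (x, y', z) \<in> S}"
  let ?C3 = "{(x, y, z). \<exists>z'. (x, y, z') \<in> S}"
  have "cylinder1 ?C1" "cylinder2 ?C2" "cylinder3 ?C3"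
    unfolding cylinder1_def cylinder2_def cylinder3_def by auto
  moreover have "S = ?C1 \<inter> ?C2 \<inter> ?C3"
  proof (rule set_eqI)
    fix p :: "'a \<times> 'b \<times> 'c"
    obtain x y z where p: "p = (x, y, z)"
      by (cases p)
    have "(x, y, z) \<in> S \<longleftrightarrow>
        (\<exists>x'. (x', y, z) \<in> S) \<and> (\<exists>y'. (x, y', z) \<in> S) \<and> (\<exists>z'. (x, y, z') \<in> S)"
      using R by blast
    then show "p \<in> S \<longleftrightarrow> p \<in> ?C1 \<inter> ?C2 \<inter> ?C3"
      by (simp add: p)
  qed
  ultimately show ?L
    unfolding cylinder_intersection_def by blast
qed

definition plane_point :: "'a::ab_group_add \<Rightarrow> 'a \<times> 'a \<Rightarrow> 'a \<times> 'a \<times> 'a" where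
  "plane_point T = (\<lambda>(x, y). (x, y, T - x - y))"

lemma inj_plane_point: "inj (plane_point T)"
  by (auto simp: inj_def plane_point_def)

lemma range_plane_point: "range (plane_point T) = {(x, y, z). x + y + z = T}"
proof -
  have "(x, y, z) \<in> range (plane_point T)" if "x + y + z = T" for x y z
    using that by (intro range_eqI[of _ _ "(x, y)"]) (auto simp: plane_point_def)
  then show ?thesis
    by (auto simp: plane_point_def)
qed

lemma plane_point_image_iff:
  "(x, y, z) \<in> plane_point T ` D \<longleftrightarrow> x + y + z = T \<and> (x, y) \<in> D"
  by (auto simp: plane_point_def image_iff intro!: bexI[of _ "(x, y)"])

text \<open>A star with tips in the plane moves each coordinate of its centre by the same amount
  \<open>d\<close>, so the tips project to a corner. The centre itself lies in the plane only if
  \<open>d = 0\<close>.\<close>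

lemma cylinder_intersection_plane_iff:
  "cylinder_intersection (plane_point T ` D) \<longleftrightarrow> corner_free D"
proof
  assume L: "cylinder_intersection (plane_point T ` D)"
  show "corner_free D"
    unfolding corner_free_def
  proof (intro allI impI)
    fix a b d
    assume D: "(a + d, b) \<in> D \<and> (a, b + d) \<in> D \<and> (a, b) \<in> D"
    \<comment> \<open>The points of the plane above \<open>(a + d, b)\<close> and
      \<open>(a, b + d)\<close> share this third coordinate, so \<open>(a, b, ?z)\<close> is the
      centre of the star.\<close>
    let ?z = "T - a - b - d"
    have "(a + d, b, ?z) \<in> plane_point T ` D" "(a, b + d, ?z) \<in> plane_point T ` D"
         "(a, b, T - a - b) \<in> plane_point T ` D"
      using D by (auto simp: plane_point_image_iff algebra_simps)
    then have "(a, b, ?z) \<in> plane_point T ` D"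
      using L unfolding cylinder_intersection_iff_star_closed by blast
    then show "d = 0"
      by (simp add: plane_point_image_iff)
  qed
next
  assume R: "corner_free D"
  show "cylinder_intersection (plane_point T ` D)"
    unfolding cylinder_intersection_iff_star_closed plane_point_image_iff
  proof (intro allI impI, elim conjE)
    fix x x' y y' z z'
    assume sums: "x' + y + z = T" "x + y' + z = T" "x + y + z' = T"
      and D: "(x', y) \<in> D" "(x, y') \<in> D" "(x, y) \<in> D"
    \<comment> \<open>Both \<open>x' + y\<close> and \<open>x + y'\<close> equal
      \<open>T - z\<close>, hence \<open>y' - y\<close> is the same difference.\<close>
    define d where "d = x' - x"
    have "x' = x + d" "y' = y + d"
      using sums by (auto simp: d_def algebra_simps)
    then show "x + y + z = T \<and> (x, y) \<in> D"
      using R D sums unfolding corner_free_def by fastforce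
  qed
qed

text \<open>The labels are read off from \<open>X\<close>: in its nonconstant triples the first
  entry arises from the third by swapping 0 with 2 and 1 with 3 (a flip of \<open>a\<close>), the
  second by swapping 0 with 3 and 1 with 2 (a flip of \<open>b\<close>).\<close>

definition encode_digit :: "2 \<Rightarrow> 2 \<Rightarrow> 4" where
  "encode_digit a b =
     (if b = 0 then (if a = 0 then 0 else 2) else (if a = 0 then 3 else 1))"

lemma Z2_cases: "(a::2) = 0 \<or> a = 1"
  using exhaust_2[of a] by auto

lemma Z4_cases: "(u::4) = 0 \<or> u = 1 \<or> u = 2 \<or> u = 3"
  using exhaust_4[of u] by auto

lemma encode_digit_inject: "encode_digit a b = encode_digit a' b' \<longleftrightarrow> a = a' \<and> b = b'"
  using Z2_cases[of a] Z2_cases[of b] Z2_cases[of a'] Z2_cases[of b']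
  by (elim disjE) (simp_all add: encode_digit_def)

lemma encode_digit_surj: "\<exists>a b. u = encode_digit a b"
proof -
  have "encode_digit 0 0 = 0" "encode_digit 1 1 = 1" "encode_digit 1 0 = 2" "encode_digit 0 1 = 3"
    by (simp_all add: encode_digit_def)
  then show ?thesis
    using Z4_cases[of u] by metis
qed

text \<open>The eight choices of \<open>a\<close>, \<open>b\<close>, \<open>d\<close> yield the
  eight triples: the constant ones for \<open>d = 0\<close>, the others for
  \<open>d = 1\<close>.\<close>

lemma mem_X_iff_corner:
  "(u, v, w) \<in> {(0,0,0), (1,1,1), (2,2,2), (3,3,3), (0,1,2), (1,0,3), (2,3,0), (3,2,1)} \<longleftrightarrow>
     (\<exists>a b d. u = encode_digit (a + d) b \<and> v = encode_digit a (b + d) \<and> w = encode_digit a b)"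
proof -
  have Ex2: "(\<exists>a::2. P a) \<longleftrightarrow> P 0 \<or> P 1" for P
    using Z2_cases by metis
  have "(1::2) + 1 = 0"
    by simp
  then show ?thesis
    unfolding Ex2 encode_digit_def by auto
qed

definition encode :: "(2 ^ 'n) \<times> (2 ^ 'n) \<Rightarrow> 4 ^ 'n" where
  "encode = (\<lambda>(a, b). \<chi> i. encode_digit (a $ i) (b $ i))"

lemma bij_encode: "bij encode"
proof (rule bijI)
  show "inj encode"
    by (auto simp: inj_def encode_def vec_eq_iff encode_digit_inject)
  show "surj encode"
    unfolding surj_def
  proof
    fix u :: "4 ^ 'n"
    have "\<forall>i. \<exists>a b. u $ i = encode_digit a b"
      using encode_digit_surj by blast
    then obtain a b where "\<And>i. u $ i = encode_digit (a i) (b i)"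
      by metis
    then have "u = encode (\<chi> i. a i, \<chi> i. b i)"
      by (simp add: encode_def vec_eq_iff)
    then show "\<exists>p. u = encode p" ..
  qed
qed

text \<open>The digits \<open>a\<close>, \<open>b\<close>, \<open>d\<close> found in each coordinate
  assemble into vectors. The vector \<open>d\<close> may vanish in some coordinates only, which is
  where the constant triples of \<open>X\<close> enter.\<close>

lemma all_mem_X_iff_corner:
  fixes u v w :: "4 ^ 'n"
  assumes X: "X = {(0,0,0), (1,1,1), (2,2,2), (3,3,3), (0,1,2), (1,0,3), (2,3,0), (3,2,1)}"
  shows "(\<forall>i. (u $ i, v $ i, w $ i) \<in> X) \<longleftrightarrow>
    (\<exists>a b d. u = encode (a + d, b) \<and> v = encode (a, b + d) \<and> w = encode (a, b))"
proof
  assume "\<forall>i. (u $ i, v $ i, w $ i) \<in> X"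
  then obtain a b d where
    "\<And>i. u $ i = encode_digit (a i + d i) (b i) \<and> v $ i = encode_digit (a i) (b i + d i) \<and>
          w $ i = encode_digit (a i) (b i)"
    unfolding X mem_X_iff_corner by metis
  then have "u = encode ((\<chi> i. a i) + (\<chi> i. d i), \<chi> i. b i) \<and>
      v = encode (\<chi> i. a i, (\<chi> i. b i) + (\<chi> i. d i)) \<and> w = encode (\<chi> i. a i, \<chi> i. b i)"
    by (simp add: encode_def vec_eq_iff)
  then show "\<exists>a b d. u = encode (a + d, b) \<and> v = encode (a, b + d) \<and> w = encode (a, b)"
    by blast
next
  assume "\<exists>a b d. u = encode (a + d, b) \<and> v = encode (a, b + d) \<and> w = encode (a, b)"
  then obtain a b d where "u = encode (a + d, b)" "v = encode (a, b + d)" "w = encode (a, b)"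
    by blast
  then have "u $ i = encode_digit (a $ i + d $ i) (b $ i) \<and>
      v $ i = encode_digit (a $ i) (b $ i + d $ i) \<and> w $ i = encode_digit (a $ i) (b $ i)" for i
    by (simp add: encode_def)
  then show "\<forall>i. (u $ i, v $ i, w $ i) \<in> X"
    unfolding X mem_X_iff_corner by blast
qed

lemma X_free_encode_iff:
  fixes D :: "((2 ^ 'n) \<times> (2 ^ 'n)) set"
  assumes X: "X = {(0,0,0), (1,1,1), (2,2,2), (3,3,3), (0,1,2), (1,0,3), (2,3,0), (3,2,1)}"
  shows "X_free X (encode ` D) \<longleftrightarrow> corner_free D"
proof -
  have inj: "encode p = encode q \<longleftrightarrow> p = q" for p q :: "(2 ^ 'n) \<times> (2 ^ 'n)"
    using bij_encode by (meson bij_is_inj injD)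
  \<comment> \<open>The three points of a corner either all coincide or are pairwise distinct, so
    the distinctness in \<open>X_free\<close> amounts to \<open>d \<noteq> 0\<close>.\<close>
  have distinct: "(a + d, b) \<noteq> (a, b + d) \<and> (a + d, b) \<noteq> (a, b) \<and> (a, b + d) \<noteq> (a, b) \<longleftrightarrow> d \<noteq> 0"
    for a b d :: "2 ^ 'n"
    by simp
  have mem: "encode p \<in> encode ` D \<longleftrightarrow> p \<in> D" for p
    using inj_image_mem_iff[OF bij_is_inj[OF bij_encode]] .
  show ?thesis
  proof
    assume free: "X_free X (encode ` D)"
    show "corner_free D"
      unfolding corner_free_def
    proof (intro allI impI)
      fix a b d
      assume D: "(a + d, b) \<in> D \<and> (a, b + d) \<in> D \<and> (a, b) \<in> D"
      let ?u = "encode (a + d, b)" and ?v = "encode (a, b + d)" and ?w = "encode (a, b)"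
      have "\<forall>i. (?u $ i, ?v $ i, ?w $ i) \<in> X"
        unfolding all_mem_X_iff_corner[OF X] by (intro exI conjI) (rule refl)+
      moreover have "?u \<in> encode ` D" "?v \<in> encode ` D" "?w \<in> encode ` D"
        using D by (simp_all add: mem)
      ultimately have "\<not> (?u \<noteq> ?v \<and> ?u \<noteq> ?w \<and> ?v \<noteq> ?w)"
        using free unfolding X_free_def by blast
      then show "d = 0"
        by (simp only: inj distinct not_not)
    qed
  next
    assume free: "corner_free D"
    show "X_free X (encode ` D)"
      unfolding X_free_def
    proof (intro ballI impI)
      fix u v w
      assume D: "u \<in> encode ` D" "v \<in> encode ` D" "w \<in> encode ` D"
        and ne: "u \<noteq> v \<and> u \<noteq> w \<and> v \<noteq> w"
      show "\<exists>i. (u $ i, v $ i, w $ i) \<notin> X"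
      proof (rule ccontr)
        assume "\<nexists>i. (u $ i, v $ i, w $ i) \<notin> X"
        then have "\<forall>i. (u $ i, v $ i, w $ i) \<in> X"
          by blast
        then obtain a b d where
          uvw: "u = encode (a + d, b)" "v = encode (a, b + d)" "w = encode (a, b)"
          unfolding all_mem_X_iff_corner[OF X] by (elim exE conjE)
        have "d = 0"
          using D free unfolding uvw mem corner_free_def by blast
        then show False
          using ne by (simp add: uvw)
      qed
    qed
  qed
qed

theorem theorem19:
  fixes T :: "2 ^ 'n"
    and X :: "(4 \<times> 4 \<times> 4) set"
    and f :: "(2 ^ 'n) \<times> (2 ^ 'n) \<times> (2 ^ 'n) \<Rightarrow> nat"
  assumes "X = {(0,0,0), (1,1,1), (2,2,2), (3,3,3), (0,1,2), (1,0,3), (2,3,0), (3,2,1)}"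
    and "range f \<subseteq> {0, 1}"
    and "\<And>x y z. f (x, y, z) = 1 \<longleftrightarrow> x + y + z = T"
  shows "alpha3 f = Max {card W | W :: (4 ^ 'n) set. X_free X W}"
proof -
  have plane: "f -` {1} = range (plane_point T)"
    using assms(3) by (auto simp: range_plane_point)
  have onto: "\<exists>D. W = encode ` D" for W :: "(4 ^ 'n) set"
    using surj_image_vimage_eq[OF bij_is_surj[OF bij_encode]] by metis
  \<comment> \<open>The sets of cardinalities agree, not just their maxima: both parametrisations
    are injective, and every subset of the plane or of the vectors over \<open>4\<close> is an
    image.\<close>
  have "{card S | S. cylinder_intersection S \<and> S \<subseteq> f -` {1}} =
      {card (plane_point T ` D) | D. cylinder_intersection (plane_point T ` D)}"
    unfolding plane by (auto simp: subset_image_iff)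
  also have "\<dots> = {card D | D :: ((2 ^ 'n) \<times> (2 ^ 'n)) set. corner_free D}"
    by (simp add: cylinder_intersection_plane_iff card_image inj_on_subset[OF inj_plane_point])
  also have "\<dots> = {card (encode ` D) | D :: ((2 ^ 'n) \<times> (2 ^ 'n)) set. X_free X (encode ` D)}"
    by (simp add: X_free_encode_iff[OF assms(1)] card_image
        inj_on_subset[OF bij_is_inj[OF bij_encode]])
  also have "\<dots> = {card W | W :: (4 ^ 'n) set. X_free X W}"
    by (intro Collect_cong) (metis onto)
  finally show ?thesis
    by (simp add: alpha3_def)
qed

end
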